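(* Let $M_0, M_1, \dots, M_n$ be Event-B machines such that $M_0 \preccurlyeq_W M_1 \preccurlyeq_W \cdots \preccurlyeq_W M_n$ is a refinement chain obeying the development strategy described in the context (events may be renamed and split along the chain), and let $g_{1,n}$ be the associated partial function from $\alpha M_n$ to $\alpha M_0$ mapping each event of $M_n$ to the event of $M_0$ it ultimately refines, if any. If $M_n$ is deadlock free and $M_n$ does not contain any anticipated events, then $$M_n \models G\,F\Big(\bigvee_{e\in g_{1,n}^{-1}(\alpha M_0)}[e]\Big).$$
   Context: Fix an infinite set $\Sigma$ of event names. **Machines.** An Event-B machine $M$ has a set of states (values $v$ of its variables), an invariant $I(v)$, a non-empty set of initial states, and a finite set $\alpha M\subseteq\Sigma$ of events (its alphabet; initialisation is not in it). Each event $e$ has a guard $G_e(x,v)$ and a before-after predicate $BA_e(v,x,v')$, where $x$ are the (optional) parameters. Event $e$ is enabled in $v$ if $\exists x.\,G_e(x,v)$; write $v\xrightarrow{e}v'$ if $\exists x.\,G_e(x,v)\wedge BA_e(v,x,v')$. All initial states satisfy $I$, and $I(v)$ and $v\xrightarrow{e}v'$ imply $I(v')$. Events are feasible: if $I(v)$ holds and $e$ is enabled in $v$ then $v\xrightarrow{e}v'$ for some $v'$. $M$ is deadlock free if in every state satisfying $I$ at least one event is enabled. Every event carries exactly one label: ordinary, anticipated or convergent. **Traces.** A trace of $M$ is a maximal execution: either an infinite sequence $\langle e_0,e_1,\dots\rangle$ of events such that $v_0\xrightarrow{e_0}v_1\xrightarrow{e_1}\cdots$ for some states with $v_0$ initial,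 or a finite sequence $\langle e_0,\dots,e_{k-1}\rangle$ with $v_0\xrightarrow{e_0}\cdots\xrightarrow{e_{k-1}}v_k$, $v_0$ initial, and no event enabled in $v_k$. **Refinement.** Let $M$ (states $v$, invariant $I$) and $M'$ (states $w$, invariant $I'$) be machines, with a specification of which events of $M'$ refine which events of $M$ (each event of $M'$ refines at most one event of $M$, several events of $M'$ may refine the same event of $M$; an event refining none is called new). $M\preccurlyeq_W M'$ means there are a linking invariant $J(v,w)$ and a natural-number-valued variant $V(w)$ such that: every initial $w$ has an initial $v$ with $J(v,w)$; and for all $v,w$ with $I(v), I'(w), J(v,w)$ and all $e'\in\alpha M'$: (feasibility) if $e'$ is enabled in $w$ then $w\xrightarrow{e'}w'$ for some $w'$; (guard strengthening) if $e'$ refines $e$ and $e'$ is enabled in $w$ then $e$ is enabled in $v$; (simulation) if $w\xrightarrow{e'}w'$ and $e'$ refines $e$ then there is $v'$ with $v\xrightarrow{e}v'$ and $J(v',w')$, while if $w\xrightarrow{e'}w'$ and $e'$ is new then $J(v,w')$; (variant) if $w\xrightarrow{e'}w'$ then $V(w')<V(w)$ when $e'$ is convergent and $V(w')\le V(w)$ when $e'$ is anticipated. **Development strategy** for a chain $M_0\preccurlyeq_W\cdots\preccurlyeq_W M_n$: all events of $M_0$ are ordinary; each event of $M_k$ is refined by at least one event of $M_{k+1}$; each new event of $M_{k+1}$ is anticipated or convergent; each event of $M_{k+1}$ refining an anticipated event of $M_k$ is anticipated or convergent; each event of $M_{k+1}$ refining a convergent or ordinary event of $M_k$ is ordinary.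 **Renaming functions.** For $1\le k\le n$, $f_k$ is the partial surjection from $\alpha M_k$ to $\alpha M_{k-1}$ with $f_k(e')=e$ iff $e'$ refines $e$ (undefined on new events). $g_{1,n}$ is the composition applying $f_n$ first, then $f_{n-1}$, and so on down to $f_1$ (a partial function; the identity on $\alpha M_0$ if $n=0$). **LTL.** Formulae: $\phi::=true\mid[x]\mid\neg\phi\mid\phi\vee\phi\mid\phi\,U\,\phi$ with $x\in\Sigma$. For a finite or infinite sequence $u$ of events, $u^k$ denotes $u$ with its first $k$ elements removed ($k$ ranges over indices not exceeding the length of $u$). $u\models true$ always; $u\models[x]$ iff $u$ is non-empty with first element $x$; $\neg,\vee$ as usual; $u\models\phi_1U\phi_2$ iff there is $k\ge0$ with $u^k\models\phi_2$ and $u^i\models\phi_1$ for all $i<k$. Derived: $u\models F\phi$ iff $u^i\models\phi$ for some $i\ge 0$; $u\models G\phi$ iff $u^i\models\phi$ for all $i\ge 0$. $M\models\phi$ iff every trace of $M$ satisfies $\phi$. *)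

theory Defs
  imports
    "HOL-Library.Omega_Words_Fun"
    "HOL-Library.Extended_Nat"
    "HOL-Library.Infinite_Typeclass"
begin

section \<open>Machines\<close>

datatype label = Ordinary | Anticipated | Convergent

text \<open>
  The machines of a refinement chain live in different state spaces. They share the type
  \<open>'s\<close>, which can be taken to be the disjoint sum of all these spaces; each machine singles out
  its own states by \<open>states\<close>. In the same way \<open>'p\<close> comprises the parameter values of all events:
  the parameters an event admits are restricted by its guard, and an event without parameters
  is one whose guard and before-after predicate ignore that argument.
  Guards, before-after predicates and labels are only meaningful for events in the alphabet.
\<close>

record ('s, 'p, 'e) machine =
  states :: "'s set"
  invariant :: "'s \<Rightarrow> bool"
  initial :: "'s set"
  alphabet :: "'e set"
  guard :: "'e \<Rightarrow> 'p \<Rightarrow> 's \<Rightarrow> bool"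
  before_after :: "'e \<Rightarrow> 's \<Rightarrow> 'p \<Rightarrow> 's \<Rightarrow> bool"
  event_label :: "'e \<Rightarrow> label"

definition enabled :: "('s, 'p, 'e) machine \<Rightarrow> 'e \<Rightarrow> 's \<Rightarrow> bool" where
  "enabled M e v \<longleftrightarrow> e \<in> alphabet M \<and> v \<in> states M \<and> (\<exists>x. guard M e x v)"

definition step :: "('s, 'p, 'e) machine \<Rightarrow> 's \<Rightarrow> 'e \<Rightarrow> 's \<Rightarrow> bool" where
  "step M v e v' \<longleftrightarrow> e \<in> alphabet M \<and> v \<in> states M \<and> v' \<in> states M \<and>
     (\<exists>x. guard M e x v \<and> before_after M e v x v')"

definition event_b_machine :: "('s, 'p, 'e) machine \<Rightarrow> bool" where
  "event_b_machine M \<longleftrightarrow>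
     finite (alphabet M) \<and>
     initial M \<noteq> {} \<and> initial M \<subseteq> states M \<and>
     (\<forall>v\<in>initial M. invariant M v) \<and>
     (\<forall>v e v'. invariant M v \<longrightarrow> step M v e v' \<longrightarrow> invariant M v') \<and>
     (\<forall>v e. invariant M v \<longrightarrow> enabled M e v \<longrightarrow> (\<exists>v'. step M v e v'))"

definition deadlock_free :: "('s, 'p, 'e) machine \<Rightarrow> bool" where
  "deadlock_free M \<longleftrightarrow> (\<forall>v\<in>states M. invariant M v \<longrightarrow> (\<exists>e. enabled M e v))"

section \<open>Finite and infinite sequences, traces\<close>

datatype 'e fiword = Fin "'e list" | Inf "'e word"

fun fiword_length :: "'e fiword \<Rightarrow> enat" where
  "fiword_length (Fin xs) = enat (length xs)"
| "fiword_length (Inf w) = \<infinity>"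

fun fiword_drop :: "nat \<Rightarrow> 'e fiword \<Rightarrow> 'e fiword" where
  "fiword_drop k (Fin xs) = Fin (drop k xs)"
| "fiword_drop k (Inf w) = Inf (suffix k w)"

fun starts_with :: "'e fiword \<Rightarrow> 'e \<Rightarrow> bool" where
  "starts_with (Fin xs) x \<longleftrightarrow> xs \<noteq> [] \<and> hd xs = x"
| "starts_with (Inf w) x \<longleftrightarrow> w 0 = x"

fun is_trace :: "('s, 'p, 'e) machine \<Rightarrow> 'e fiword \<Rightarrow> bool" where
  "is_trace M (Fin xs) \<longleftrightarrow>
     (\<exists>\<sigma> :: nat \<Rightarrow> 's. \<sigma> 0 \<in> initial M \<and>
        (\<forall>i < length xs. step M (\<sigma> i) (xs ! i) (\<sigma> (Suc i))) \<and>
        (\<forall>e. \<not> enabled M e (\<sigma> (length xs))))"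
| "is_trace M (Inf w) \<longleftrightarrow>
     (\<exists>\<sigma> :: nat \<Rightarrow> 's. \<sigma> 0 \<in> initial M \<and> (\<forall>i. step M (\<sigma> i) (w i) (\<sigma> (Suc i))))"

section \<open>LTL\<close>

datatype 'e ltl =
    LTrue
  | LEvent 'e
  | LNot "'e ltl"
  | LOr "'e ltl" "'e ltl"
  | LUntil "'e ltl" "'e ltl"

primrec sat :: "'e fiword \<Rightarrow> 'e ltl \<Rightarrow> bool"  (infix \<open>\<Turnstile>\<close> 50) where
  "u \<Turnstile> LTrue \<longleftrightarrow> True"
| "u \<Turnstile> LEvent x \<longleftrightarrow> starts_with u x"
| "u \<Turnstile> LNot \<phi> \<longleftrightarrow> \<not> u \<Turnstile> \<phi>"
| "u \<Turnstile> LOr \<phi> \<psi> \<longleftrightarrow> u \<Turnstile> \<phi> \<or> u \<Turnstile> \<psi>"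
| "u \<Turnstile> LUntil \<phi> \<psi> \<longleftrightarrow>
     (\<exists>k. enat k \<le> fiword_length u \<and> fiword_drop k u \<Turnstile> \<psi> \<and> (\<forall>i<k. fiword_drop i u \<Turnstile> \<phi>))"

definition LFinally :: "'e ltl \<Rightarrow> 'e ltl" where
  "LFinally \<phi> = LUntil LTrue \<phi>"

definition LGlobally :: "'e ltl \<Rightarrow> 'e ltl" where
  "LGlobally \<phi> = LNot (LFinally (LNot \<phi>))"

lemma sat_LFinally:
  "u \<Turnstile> LFinally \<phi> \<longleftrightarrow> (\<exists>i. enat i \<le> fiword_length u \<and> fiword_drop i u \<Turnstile> \<phi>)"
  by (simp add: LFinally_def)

lemma sat_LGlobally:
  "u \<Turnstile> LGlobally \<phi> \<longleftrightarrow> (\<forall>i. enat i \<le> fiword_length u \<longrightarrow> fiword_drop i u \<Turnstile> \<phi>)"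
  by (simp add: LGlobally_def sat_LFinally)

text \<open>
  The disjunction of the atoms \<open>[e]\<close> for \<open>e\<close> in a finite set, taken in an arbitrary order
  (the order is irrelevant for satisfaction, see below); the empty disjunction is false.
\<close>

definition LEvents :: "'e set \<Rightarrow> 'e ltl" where
  "LEvents A = foldr (\<lambda>e \<phi>. LOr (LEvent e) \<phi>) (SOME es. set es = A \<and> distinct es) (LNot LTrue)"

lemma sat_LEvents:
  assumes "finite A"
  shows "u \<Turnstile> LEvents A \<longleftrightarrow> (\<exists>e\<in>A. u \<Turnstile> LEvent e)"
proof -
  have foldr: "u \<Turnstile> foldr (\<lambda>e \<phi>. LOr (LEvent e) \<phi>) es (LNot LTrue) \<longleftrightarrow>
      (\<exists>e\<in>set es. u \<Turnstile> LEvent e)" for es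
    by (induction es) auto
  have "set (SOME es. set es = A \<and> distinct es) = A"
    using someI_ex[OF finite_distinct_list[OF assms]] by blast
  then show ?thesis
    unfolding LEvents_def foldr by simp
qed

definition machine_sat :: "('s, 'p, 'e) machine \<Rightarrow> 'e ltl \<Rightarrow> bool"  (infix \<open>\<Turnstile>\<^sub>M\<close> 50) where
  "M \<Turnstile>\<^sub>M \<phi> \<longleftrightarrow> (\<forall>u. is_trace M u \<longrightarrow> u \<Turnstile> \<phi>)"

section \<open>Refinement\<close>

text \<open>
  The specification of which events of \<open>M'\<close> refine which events of \<open>M\<close> is a partial map \<open>f\<close>:
  \<open>f e' = Some e\<close> says that \<open>e'\<close> refines \<open>e\<close>, and an event \<open>e'\<close> of \<open>M'\<close> with \<open>f e' = None\<close> is new.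
\<close>

definition refinement_spec ::
  "('s, 'p, 'e) machine \<Rightarrow> ('e \<rightharpoonup> 'e) \<Rightarrow> ('s, 'p, 'e) machine \<Rightarrow> bool" where
  "refinement_spec M f M' \<longleftrightarrow> dom f \<subseteq> alphabet M' \<and> ran f \<subseteq> alphabet M"

definition refinement_via ::
  "('s, 'p, 'e) machine \<Rightarrow> ('e \<rightharpoonup> 'e) \<Rightarrow> ('s, 'p, 'e) machine \<Rightarrow>
   ('s \<Rightarrow> 's \<Rightarrow> bool) \<Rightarrow> ('s \<Rightarrow> nat) \<Rightarrow> bool" where
  "refinement_via M f M' J V \<longleftrightarrow>
     (\<forall>w\<in>initial M'. \<exists>v\<in>initial M. J v w) \<and>
     (\<forall>v\<in>states M. \<forall>w\<in>states M'. invariant M v \<longrightarrow> invariant M' w \<longrightarrow> J v w \<longrightarrow>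
       (\<forall>e'\<in>alphabet M'.
          (enabled M' e' w \<longrightarrow> (\<exists>w'. step M' w e' w')) \<and>
          (\<forall>e. f e' = Some e \<longrightarrow> enabled M' e' w \<longrightarrow> enabled M e v) \<and>
          (\<forall>w' e. step M' w e' w' \<longrightarrow> f e' = Some e \<longrightarrow> (\<exists>v'. step M v e v' \<and> J v' w')) \<and>
          (\<forall>w'. step M' w e' w' \<longrightarrow> f e' = None \<longrightarrow> J v w') \<and>
          (\<forall>w'. step M' w e' w' \<longrightarrow>
             (event_label M' e' = Convergent \<longrightarrow> V w' < V w) \<and>
             (event_label M' e' = Anticipated \<longrightarrow> V w' \<le> V w))))"

definition refines ::
  "('s, 'p, 'e) machine \<Rightarrow> ('e \<rightharpoonup> 'e) \<Rightarrow> ('s, 'p, 'e) machine \<Rightarrow> bool" where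
  "refines M f M' \<longleftrightarrow> refinement_spec M f M' \<and> (\<exists>J V. refinement_via M f M' J V)"

text \<open>
  In a chain \<open>M 0, \<dots>, M n\<close> the map \<open>f (Suc k)\<close> specifies which events of \<open>M (Suc k)\<close>
  refine which events of \<open>M k\<close>; the value \<open>f 0\<close> is not used.
\<close>

definition refinement_chain ::
  "(nat \<Rightarrow> ('s, 'p, 'e) machine) \<Rightarrow> (nat \<Rightarrow> 'e \<rightharpoonup> 'e) \<Rightarrow> nat \<Rightarrow> bool" where
  "refinement_chain M f n \<longleftrightarrow> (\<forall>k<n. refines (M k) (f (Suc k)) (M (Suc k)))"

definition development_strategy ::
  "(nat \<Rightarrow> ('s, 'p, 'e) machine) \<Rightarrow> (nat \<Rightarrow> 'e \<rightharpoonup> 'e) \<Rightarrow> nat \<Rightarrow> bool" where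
  "development_strategy M f n \<longleftrightarrow>
     (\<forall>e\<in>alphabet (M 0). event_label (M 0) e = Ordinary) \<and>
     (\<forall>k<n.
        (\<forall>e\<in>alphabet (M k). \<exists>e'\<in>alphabet (M (Suc k)). f (Suc k) e' = Some e) \<and>
        (\<forall>e'\<in>alphabet (M (Suc k)). f (Suc k) e' = None \<longrightarrow>
           event_label (M (Suc k)) e' \<in> {Anticipated, Convergent}) \<and>
        (\<forall>e'\<in>alphabet (M (Suc k)). \<forall>e\<in>alphabet (M k). f (Suc k) e' = Some e \<longrightarrow>
           event_label (M k) e = Anticipated \<longrightarrow>
           event_label (M (Suc k)) e' \<in> {Anticipated, Convergent}) \<and>
        (\<forall>e'\<in>alphabet (M (Suc k)). \<forall>e\<in>alphabet (M k). f (Suc k) e' = Some e \<longrightarrow>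
           event_label (M k) e \<in> {Convergent, Ordinary} \<longrightarrow>
           event_label (M (Suc k)) e' = Ordinary))"

text \<open>
  \<open>renaming M f n\<close> is the partial function $g_{1,n}$, i.e. $f_n$ followed by $f_{n-1}$, \<dots>, $f_1$.
\<close>

primrec renaming ::
  "(nat \<Rightarrow> ('s, 'p, 'e) machine) \<Rightarrow> (nat \<Rightarrow> 'e \<rightharpoonup> 'e) \<Rightarrow> nat \<Rightarrow> ('e \<rightharpoonup> 'e)" where
  "renaming M f 0 = Some |` alphabet (M 0)"
| "renaming M f (Suc n) = renaming M f n \<circ>\<^sub>m f (Suc n)"

end

theory Submission
  imports Defs
begin

text \<open>
  An infinite trace of \<open>M n\<close> is abstracted level by level, where a step by a new event becomes a
  stuttering step. By induction along the chain, a run with infinitely many non-anticipated events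
  has infinitely many events that ultimately refine an event of \<open>M 0\<close>: the variant excludes that
  almost all of these events are convergent, so infinitely many are ordinary; ordinary events are
  not new and refine events that are not anticipated, so the abstract run again has infinitely
  many non-anticipated events.
\<close>

text \<open>\<open>None\<close> keeps a position in place instead of deleting it. Concrete and
  abstract runs thus share their indices, and an abstract run performing only finitely many events
  is still covered.\<close>

definition stuttering_run ::
  "('s, 'p, 'e) machine \<Rightarrow> (nat \<Rightarrow> 's) \<Rightarrow> (nat \<Rightarrow> 'e option) \<Rightarrow> bool" where
  "stuttering_run M \<sigma> a \<longleftrightarrow> \<sigma> 0 \<in> initial M \<and>
     (\<forall>i. case a i of None \<Rightarrow> \<sigma> (Suc i) = \<sigma> i | Some e \<Rightarrow> step M (\<sigma> i) e (\<sigma> (Suc i)))"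

lemma stuttering_run_None: "stuttering_run M \<sigma> a \<Longrightarrow> a i = None \<Longrightarrow> \<sigma> (Suc i) = \<sigma> i"
  unfolding stuttering_run_def by (metis option.simps(4))

lemma stuttering_run_Some:
  "stuttering_run M \<sigma> a \<Longrightarrow> a i = Some e \<Longrightarrow> step M (\<sigma> i) e (\<sigma> (Suc i))"
  unfolding stuttering_run_def by (metis option.simps(5))

lemma event_b_machine_initial:
  "event_b_machine M \<Longrightarrow> v \<in> initial M \<Longrightarrow> v \<in> states M \<and> invariant M v"
  unfolding event_b_machine_def by blast

lemma event_b_machine_step:
  "event_b_machine M \<Longrightarrow> invariant M v \<Longrightarrow> step M v e v' \<Longrightarrow> v' \<in> states M \<and> invariant M v'"
  unfolding event_b_machine_def step_def by blast

lemma stuttering_run_invariant: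
  assumes "event_b_machine M" and "stuttering_run M \<sigma> a"
  shows "\<sigma> i \<in> states M \<and> invariant M (\<sigma> i)"
proof (induction i)
  case 0
  show ?case
    using assms(2) event_b_machine_initial[OF assms(1)] unfolding stuttering_run_def by simp
next
  case (Suc i)
  then show ?case
    using event_b_machine_step[OF assms(1)] stuttering_run_None[OF assms(2), of i]
      stuttering_run_Some[OF assms(2), of i]
    by (cases "a i") auto
qed

text \<open>Forward simulation, choosing abstract states one at a time. \<open>Option.bind\<close>
  sends both an existing stutter and a new event to \<open>None\<close>.\<close>

lemma stuttering_run_abstract:
  assumes M: "event_b_machine M" and M': "event_b_machine M'"
    and ref: "refinement_via M f M' J V"
    and run: "stuttering_run M' \<sigma> a"
  obtains \<tau> where "stuttering_run M \<tau> (\<lambda>i. Option.bind (a i) f)" and "\<And>i. J (\<tau> i) (\<sigma> i)"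
proof -
  let ?b = "\<lambda>i. Option.bind (a i) f"
  \<comment> \<open>The obligations in \<open>refinement_via\<close> apply only to linked states
    satisfying their invariants, so the choice must preserve these; the clause for
    \<open>i = 0\<close> records that the first choice is initial.\<close>
  let ?P = "\<lambda>i v. v \<in> states M \<and> invariant M v \<and> J v (\<sigma> i) \<and> (i = 0 \<longrightarrow> v \<in> initial M)"
  let ?Q = "\<lambda>i v v'. case ?b i of None \<Rightarrow> v' = v | Some e \<Rightarrow> step M v e v'"
  have \<sigma>: "\<sigma> i \<in> states M'" "invariant M' (\<sigma> i)" for i
    using stuttering_run_invariant[OF M' run] by auto
  have "\<exists>v. ?P 0 v"
    using run ref event_b_machine_initial[OF M]
    unfolding stuttering_run_def refinement_via_def by blast
  moreover have "\<exists>v'. ?P (Suc i) v' \<and> ?Q i v v'" if v: "?P i v" for i v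
  proof (cases "a i")
    case None
    then show ?thesis
      using v stuttering_run_None[OF run None] by auto
  next
    case (Some e')
    have st: "step M' (\<sigma> i) e' (\<sigma> (Suc i))"
      using run Some by (rule stuttering_run_Some)
    then have e': "e' \<in> alphabet M'"
      by (simp add: step_def)
    show ?thesis
    proof (cases "f e'")
      case None
      then have "J v (\<sigma> (Suc i))"
        using ref v \<sigma>[of i] st e' unfolding refinement_via_def by blast
      then show ?thesis
        using v None Some by auto
    next
      case (Some e)
      then obtain v' where "step M v e v'" "J v' (\<sigma> (Suc i))"
        using ref v \<sigma>[of i] st e' unfolding refinement_via_def by blast
      moreover from this have "v' \<in> states M \<and> invariant M v'"
        using event_b_machine_step[OF M] v by blast
      ultimately show ?thesis
        using Some \<open>a i = Some e'\<close> by auto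
    qed
  qed
  ultimately obtain \<tau> where "\<And>i. ?P i (\<tau> i)" "\<And>i. ?Q i (\<tau> i) (\<tau> (Suc i))"
    using dependent_nat_choice[of ?P ?Q] by blast
  then show thesis
    using that[of \<tau>] unfolding stuttering_run_def by blast
qed

text \<open>Without ordinary events from \<open>m\<close> on, \<open>V\<close> never increases there
  and drops at infinitely many convergent steps, which is impossible in the natural numbers.\<close>

lemma infinitely_many_ordinary:
  assumes M: "event_b_machine M" and M': "event_b_machine M'"
    and ref: "refinement_via M f M' J V"
    and run: "stuttering_run M' \<sigma> a"
    and inf: "\<forall>m. \<exists>i\<ge>m. \<exists>e. a i = Some e \<and> event_label M' e \<noteq> Anticipated"
  shows "\<exists>i\<ge>m. \<exists>e. a i = Some e \<and> event_label M' e = Ordinary"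
proof (rule ccontr)
  assume no_ordinary: "\<not> ?thesis"
  \<comment> \<open>The variant conditions are only guaranteed at concrete states linked to an
    abstract one; \<open>\<tau>\<close> supplies these partners.\<close>
  obtain \<tau> where \<tau>: "stuttering_run M \<tau> (\<lambda>i. Option.bind (a i) f)" "\<And>i. J (\<tau> i) (\<sigma> i)"
    using stuttering_run_abstract[OF M M' ref run] by blast
  have variant:
    "(event_label M' e = Convergent \<longrightarrow> V (\<sigma> (Suc i)) < V (\<sigma> i)) \<and>
     (event_label M' e = Anticipated \<longrightarrow> V (\<sigma> (Suc i)) \<le> V (\<sigma> i))"
    if "a i = Some e" for i e
  proof -
    have "step M' (\<sigma> i) e (\<sigma> (Suc i))"
      using run that by (rule stuttering_run_Some)
    moreover from this have "e \<in> alphabet M'"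
      by (simp add: step_def)
    ultimately show ?thesis
      using ref \<tau>(2)[of i] stuttering_run_invariant[OF M \<tau>(1), of i]
        stuttering_run_invariant[OF M' run, of i]
      unfolding refinement_via_def by blast
  qed
  have decreasing: "V (\<sigma> (Suc i)) \<le> V (\<sigma> i)" if "i \<ge> m" for i
  proof (cases "a i")
    case None
    then show ?thesis
      using stuttering_run_None[OF run] by simp
  next
    case (Some e)
    then have "event_label M' e \<noteq> Ordinary"
      using no_ordinary that by blast
    then show ?thesis
      using variant[OF Some] by (cases "event_label M' e") auto
  qed
  \<comment> \<open>At \<open>i\<^sub>0\<close> the variant is least on the tail from
    \<open>m\<close>, so a single convergent step at or after \<open>i\<^sub>0\<close> already goes
    below the minimum.\<close>
  obtain i\<^sub>0 where i\<^sub>0: "i\<^sub>0 \<ge> m" "\<And>i. i \<ge> m \<Longrightarrow> V (\<sigma> i\<^sub>0) \<le> V (\<sigma> i)"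
    using exists_least_iff[of "\<lambda>x. \<exists>i\<ge>m. V (\<sigma> i) = x"] by (metis leI order_refl)
  obtain i e where i: "i \<ge> i\<^sub>0" "a i = Some e" "event_label M' e \<noteq> Anticipated"
    using inf by blast
  then have "event_label M' e = Convergent"
    using no_ordinary i\<^sub>0(1) by (cases "event_label M' e") (auto dest: order_trans)
  then have "V (\<sigma> (Suc i)) < V (\<sigma> i)"
    using variant[OF i(2)] by blast
  also have "V (\<sigma> i) \<le> V (\<sigma> i\<^sub>0)"
    using i(1)
  proof (induction i rule: dec_induct)
    case (step j)
    then show ?case
      using decreasing[of j] i\<^sub>0(1) by linarith
  qed simp
  finally show False
    using i\<^sub>0(2)[of "Suc i"] i\<^sub>0(1) i(1) by simp
qed

text \<open>The hypothesis speaks of non-anticipated rather than ordinary events because an ordinary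
  event may refine a convergent one, so only this form passes down to the abstract run.\<close>

lemma infinitely_many_renamed:
  assumes "\<forall>k\<le>n. event_b_machine (M k)"
    and "refinement_chain M f n"
    and "development_strategy M f n"
    and "stuttering_run (M n) \<sigma> a"
    and "\<forall>m. \<exists>i\<ge>m. \<exists>e. a i = Some e \<and> event_label (M n) e \<noteq> Anticipated"
  shows "\<forall>m. \<exists>i\<ge>m. \<exists>e. a i = Some e \<and> renaming M f n e \<noteq> None"
  using assms
proof (induction n arbitrary: \<sigma> a)
  case 0
  \<comment> \<open>At level 0 the renaming is the identity on the alphabet, so every performed
    event counts.\<close>
  have "e \<in> alphabet (M 0)" if "a i = Some e" for i e
    using stuttering_run_Some[OF 0(4) that] by (simp add: step_def)
  then have "renaming M f 0 e \<noteq> None" if "a i = Some e" for i e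
    using that by (simp add: restrict_map_def)
  with 0(5) show ?case
    by blast
next
  case (Suc n)
  have M: "event_b_machine (M n)" and M': "event_b_machine (M (Suc n))"
    using Suc.prems(1) by auto
  obtain J V where ref: "refinement_via (M n) (f (Suc n)) (M (Suc n)) J V"
    and spec: "refinement_spec (M n) (f (Suc n)) (M (Suc n))"
    using Suc.prems(2) unfolding refinement_chain_def refines_def by blast
  let ?b = "\<lambda>i. Option.bind (a i) (f (Suc n))"
  obtain \<tau> where \<tau>: "stuttering_run (M n) \<tau> ?b"
    using stuttering_run_abstract[OF M M' ref Suc.prems(4)] by blast
  have "\<exists>i\<ge>m. \<exists>e. ?b i = Some e \<and> event_label (M n) e \<noteq> Anticipated" for m
  proof -
    obtain i e' where i: "i \<ge> m" "a i = Some e'" "event_label (M (Suc n)) e' = Ordinary"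
      using infinitely_many_ordinary[OF M M' ref Suc.prems(4,5)] by blast
    have e': "e' \<in> alphabet (M (Suc n))"
      using stuttering_run_Some[OF Suc.prems(4) i(2)] by (simp add: step_def)
    have "f (Suc n) e' = None \<longrightarrow> event_label (M (Suc n)) e' \<in> {Anticipated, Convergent}"
      using Suc.prems(3) e' unfolding development_strategy_def by blast
    then obtain e where e: "f (Suc n) e' = Some e"
      using i(3) by auto
    then have "e \<in> alphabet (M n)"
      using spec unfolding refinement_spec_def by (meson ranI subsetD)
    then have "event_label (M n) e = Anticipated \<longrightarrow>
        event_label (M (Suc n)) e' \<in> {Anticipated, Convergent}"
      using Suc.prems(3) e e' unfolding development_strategy_def by blast
    then have "event_label (M n) e \<noteq> Anticipated"
      using i(3) by auto
    with i e show ?thesis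
      by auto
  qed
  moreover have "\<forall>k\<le>n. event_b_machine (M k)" "refinement_chain M f n"
    "development_strategy M f n"
    using Suc.prems(1-3) unfolding refinement_chain_def development_strategy_def by auto
  ultimately have "\<forall>m. \<exists>i\<ge>m. \<exists>e. ?b i = Some e \<and> renaming M f n e \<noteq> None"
    using Suc.IH \<tau> by blast
  \<comment> \<open>Indices agree and \<open>f (Suc n)\<close> is applied first, so the abstract
    event at \<open>i\<close> pulls back to the concrete event at \<open>i\<close>.\<close>
  moreover have "\<exists>e'. a i = Some e' \<and> renaming M f (Suc n) e' \<noteq> None"
    if "?b i = Some e" "renaming M f n e \<noteq> None" for i e
    using that by (auto simp: map_comp_def bind_eq_Some_conv)
  ultimately show ?case
    by blast
qed

text \<open>Yields the finiteness that \<open>sat_LEvents\<close> demands. A case split suffices: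
  the domain of a composition lies in that of the map applied first.\<close>

lemma dom_renaming:
  assumes "refinement_chain M f n"
  shows "dom (renaming M f n) \<subseteq> alphabet (M n)"
proof (cases n)
  case 0
  then show ?thesis
    by (simp add: dom_def restrict_map_def Collect_mono)
next
  case (Suc k)
  then have "dom (f n) \<subseteq> alphabet (M n)"
    using assms unfolding refinement_chain_def refines_def refinement_spec_def by simp
  moreover have "dom (renaming M f n) \<subseteq> dom (f n)"
    using Suc by (auto simp: map_comp_def split: option.splits)
  ultimately show ?thesis
    by simp
qed

lemma ran_renaming: "ran (renaming M f n) \<subseteq> alphabet (M 0)"
  by (induction n)
    (auto simp: ran_def map_comp_def restrict_map_def split: if_splits option.splits)

text \<open>The last state of a finite trace is reachable, hence satisfies the invariant, and
  deadlock freedom would enable an event there.\<close>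

lemma deadlock_free_no_finite_trace:
  assumes "event_b_machine M" and "deadlock_free M"
  shows "\<not> is_trace M (Fin es)"
proof
  assume "is_trace M (Fin es)"
  then obtain \<sigma> where \<sigma>: "\<sigma> 0 \<in> initial M"
    "\<And>i. i < length es \<Longrightarrow> step M (\<sigma> i) (es ! i) (\<sigma> (Suc i))"
    and final: "\<And>e. \<not> enabled M e (\<sigma> (length es))"
    by auto
  have "i \<le> length es \<Longrightarrow> \<sigma> i \<in> states M \<and> invariant M (\<sigma> i)" for i
  proof (induction i)
    case (Suc i)
    then show ?case
      using \<sigma>(2)[of i] event_b_machine_step[OF assms(1)] by auto
  qed (use \<sigma>(1) event_b_machine_initial[OF assms(1)] in blast)
  then show False
    using assms(2) final unfolding deadlock_free_def by blast
qed

theorem lemma3: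
  fixes M :: "nat \<Rightarrow> ('s, 'p, 'e :: infinite) machine"
    and f :: "nat \<Rightarrow> 'e \<rightharpoonup> 'e"
    and n :: nat
  assumes "\<forall>k\<le>n. event_b_machine (M k)"
    and "refinement_chain M f n"
    and "development_strategy M f n"
    and "deadlock_free (M n)"
    and "\<forall>e\<in>alphabet (M n). event_label (M n) e \<noteq> Anticipated"
  shows "M n \<Turnstile>\<^sub>M LGlobally (LFinally (LEvents (renaming M f n -` Some ` alphabet (M 0))))"
  unfolding machine_sat_def
proof (intro allI impI)
  let ?A = "renaming M f n -` Some ` alphabet (M 0)"
  fix u
  assume u: "is_trace (M n) u"
  have Mn: "event_b_machine (M n)"
    using assms(1) by simp
  obtain w where w: "u = Inf w"
    using u deadlock_free_no_finite_trace[OF Mn assms(4)] by (cases u) auto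
  then obtain \<sigma> where run: "stuttering_run (M n) \<sigma> (\<lambda>i. Some (w i))"
    using u unfolding stuttering_run_def by auto
  have "w i \<in> alphabet (M n)" for i
    using stuttering_run_Some[OF run, of i] by (simp add: step_def)
  then have *: "\<forall>m. \<exists>i\<ge>m. renaming M f n (w i) \<noteq> None"
    using infinitely_many_renamed[OF assms(1-3) run] assms(5) by blast
  have A: "e \<in> ?A" if "renaming M f n e \<noteq> None" for e
    using that ran_renaming[of M f n] by (auto simp: ran_def)
  have "?A \<subseteq> alphabet (M n)"
    using dom_renaming[OF assms(2)] by auto
  then have fin: "finite ?A"
    using Mn finite_subset unfolding event_b_machine_def by blast
  \<comment> \<open>Dropping \<open>k\<close> and then \<open>i\<close> elements makes
    \<open>w (k + i)\<close> the head, which matches the nested G and F; on an infinite word every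
    index is admissible.\<close>
  have "\<exists>i. w (k + i) \<in> ?A" for k
    using * A by (metis le_iff_add)
  then show "u \<Turnstile> LGlobally (LFinally (LEvents ?A))"
    by (simp add: w sat_LGlobally sat_LFinally sat_LEvents[OF fin] del: vimage_eq)
qed

end
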